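(* Let $M = \langle 6, 9, 20\rangle$ be the McNugget monoid. With the exception of $x = 6$ and $x = 12$, every nonzero $x \in M$ satisfies $\omega(x + 6) = \omega(x) + 1$. In particular, for each nonzero $x \in M$ with $x \neq 6, 12$, writing $x = 6q + r$ with $q, r$ nonnegative integers and $r < 6$, \[ \omega(x) = \begin{cases} q & \text{if } r = 0, \\ q + 5 & \text{if } r = 1, \\ q + 7 & \text{if } r = 2, \\ q + 2 & \text{if } r = 3, \\ q + 4 & \text{if } r = 4, \\ q + 9 & \text{if } r = 5. \end{cases} \]
   Context: The McNugget monoid is $M = \langle 6, 9, 20 \rangle = \{6a + 9b + 20c : a, b, c \in \mathbb{N}_0\}$, a monoid under addition, where $\mathbb{N}_0$ is the set of nonnegative integers. For $x, y \in M$, say that $x$ divides $y$ (in $M$) if there exists $z \in M$ with $y = x + z$. For nonzero $x \in M$, $\omega(x)$ is the smallest positive integer $m$ such that whenever $x$ divides a sum $x_1 + \cdots + x_t$ with $x_1, \ldots, x_t \in M$, there is a set $T \subset \{1, 2, \ldots, t\}$ of indices with $|T| \le m$ such that $x$ divides $\sum_{i \in T} x_i$. *)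

theory Defs
  imports Main
begin

definition McNugget :: "nat set" where
  "McNugget = {6 * a + 9 * b + 20 * c | a b c :: nat. True}"

text \<open>Divisibility is relative to the submonoid: the (additive) quotient has to lie in \<open>M\<close>.\<close>

definition divides_in :: "nat set \<Rightarrow> nat \<Rightarrow> nat \<Rightarrow> bool" where
  "divides_in M x y \<longleftrightarrow> (\<exists>z\<in>M. y = x + z)"

definition omega_bound :: "nat set \<Rightarrow> nat \<Rightarrow> nat \<Rightarrow> bool" where
  "omega_bound M x m \<longleftrightarrow>
     (\<forall>t. \<forall>y :: nat \<Rightarrow> nat.
        (\<forall>i\<in>{1..t}. y i \<in> M) \<longrightarrow>
        divides_in M x (\<Sum>i\<in>{1..t}. y i) \<longrightarrow>
        (\<exists>T. T \<subseteq> {1..t} \<and> card T \<le> m \<and> divides_in M x (\<Sum>i\<in>T. y i)))"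

definition omega :: "nat set \<Rightarrow> nat \<Rightarrow> nat" where
  "omega M x = (LEAST m. 0 < m \<and> omega_bound M x m)"

end

theory Submission
  imports Defs
begin

text \<open>
  Splitting every summand into the generators 6, 9, 20 reduces the upper bound to sums of generators
  \<open>6a + 9b + 20c = x + d\<close>. If no generator can be dropped, then \<open>d\<close> lies in the Apery set of every
  generator occurring in the sum. These sets are small, and comparing \<open>6a + 9b + 20c\<close> with \<open>x + d\<close>
  bounds \<open>a + b + c\<close>. The extreme case is a sum of copies of 6 only, with \<open>d\<close> the element of the
  Apery set of 6 congruent to \<open>-x\<close> modulo 6; this sum gives the lower bound.
\<close>

section \<open>Membership and divisibility in the monoid\<close>

lemma McNuggetI: "n = 6 * a + 9 * b + 20 * c \<Longrightarrow> n \<in> McNugget"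
  unfolding McNugget_def by blast

lemma McNuggetE:
  assumes "n \<in> McNugget"
  obtains a b c where "n = 6 * a + 9 * b + 20 * c"
  using assms unfolding McNugget_def by blast

lemma McNugget_add:
  assumes "m \<in> McNugget" "n \<in> McNugget"
  shows "m + n \<in> McNugget"
proof -
  from assms(1) obtain a b c where m: "m = 6 * a + 9 * b + 20 * c" by (rule McNuggetE)
  from assms(2) obtain a' b' c' where n: "n = 6 * a' + 9 * b' + 20 * c'" by (rule McNuggetE)
  show ?thesis
    by (rule McNuggetI[of _ "a + a'" "b + b'" "c + c'"]) (simp add: m n)
qed

lemma divides_in_McNugget_mono:
  assumes "divides_in McNugget x (6 * a + 9 * b + 20 * c)" "a \<le> a'" "b \<le> b'" "c \<le> c'"
  shows "divides_in McNugget x (6 * a' + 9 * b' + 20 * c')"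
proof -
  obtain z where z: "z \<in> McNugget" "6 * a + 9 * b + 20 * c = x + z"
    using assms(1) unfolding divides_in_def by blast
  have "6 * (a' - a) + 9 * (b' - b) + 20 * (c' - c) \<in> McNugget"
    by (rule McNuggetI) (rule refl)
  then have "z + (6 * (a' - a) + 9 * (b' - b) + 20 * (c' - c)) \<in> McNugget"
    by (rule McNugget_add[OF z(1)])
  moreover have "6 * a' + 9 * b' + 20 * c' = x + (z + (6 * (a' - a) + 9 * (b' - b) + 20 * (c' - c)))"
    using z(2) assms(2-4) by linarith
  ultimately show ?thesis unfolding divides_in_def by blast
qed

section \<open>Apery sets of the three generators\<close>

text \<open>Trades that expose a 6: 9 + 9 = 6 + 12 and 20 + 20 + 20 = 6 + 54. If no 6 can be split
  off, at most one 9 and two 20s occur.\<close>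

lemma apery_6:
  assumes "d \<in> McNugget" "\<not> divides_in McNugget 6 d"
  shows "d \<in> {0, 9, 20, 29, 40, 49}"
proof -
  obtain a b c where d: "d = 6 * a + 9 * b + 20 * c" using assms(1) by (rule McNuggetE)
  have no: "d \<noteq> 6 + (6 * a' + 9 * b' + 20 * c')" for a' b' c'
    using assms(2) McNuggetI[OF refl] unfolding divides_in_def by blast
  have "a = 0" using no[of "a - 1" b c] d by (cases "a = 0") auto
  moreover have "b \<le> 1"
    using no[of "a + 2" "b - 2" c] d by (cases "b \<le> 1") auto
  moreover have "c \<le> 2"
    using no[of "a + 9" b "c - 3"] d by (cases "c \<le> 2") auto
  ultimately have "a = 0" "b = 0 \<or> b = 1" "c = 0 \<or> c = 1 \<or> c = 2" by linarith+
  then show ?thesis using d by auto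
qed

text \<open>The trades that expose a 9 are 6 + 6 + 6 = 9 + 9 and 20 + 20 + 20 = 9 + 6 + 45.\<close>

lemma apery_9:
  assumes "d \<in> McNugget" "\<not> divides_in McNugget 9 d"
  shows "d \<in> {0, 6, 12, 20, 26, 32, 40, 46, 52}"
proof -
  obtain a b c where d: "d = 6 * a + 9 * b + 20 * c" using assms(1) by (rule McNuggetE)
  have no: "d \<noteq> 9 + (6 * a' + 9 * b' + 20 * c')" for a' b' c'
    using assms(2) McNuggetI[OF refl] unfolding divides_in_def by blast
  have "b = 0" using no[of a "b - 1" c] d by (cases "b = 0") auto
  moreover have "a \<le> 2"
    using no[of "a - 3" "b + 1" c] d by (cases "a \<le> 2") auto
  moreover have "c \<le> 2"
    using no[of "a + 1" "b + 5" "c - 3"] d by (cases "c \<le> 2") auto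
  ultimately have "b = 0" "a = 0 \<or> a = 1 \<or> a = 2" "c = 0 \<or> c = 1 \<or> c = 2" by linarith+
  then show ?thesis using d by auto
qed

text \<open>The Apery set of 20 consists of the \<open>6 * A + 9 * B\<close> with A \<le> 9 and B
  \<le> 1. These are the multiples of 3 up to 63 except 3 and 60, a form that is easy to intersect
  with the other Apery sets.\<close>

lemma apery_20:
  assumes "d \<in> McNugget" "\<not> divides_in McNugget 20 d"
  obtains e where "d = 3 * e" "d \<le> 63" "d \<noteq> 3" "d \<noteq> 60"
proof -
  obtain a b c where d: "d = 6 * a + 9 * b + 20 * c" using assms(1) by (rule McNuggetE)
  have no: "d \<noteq> 20 + (6 * a' + 9 * b' + 20 * c')" for a' b' c'
    using assms(2) McNuggetI[OF refl] unfolding divides_in_def by blast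
  have c: "c = 0" using no[of a b "c - 1"] d by (cases "c = 0") auto
  \<comment> \<open>Each pair of 9s is traded for three 6s; then ten 6s would give 60 = 20 +
    40.\<close>
  obtain h B where hB: "b = 2 * h + B" "B \<le> 1"
    using mult_div_mod_eq[of 2 b] by (metis One_nat_def less_Suc_eq_le mod_less_divisor numeral_2_eq_2 zero_less_Suc)
  define A where "A = a + 3 * h"
  have dAB: "d = 6 * A + 9 * B" "B \<le> 1" unfolding A_def using d c hB by simp_all
  have A: "A \<le> 9" using no[of "A - 10" B 2] dAB by (cases "A \<le> 9") auto
  have "d \<noteq> 60" using no[of 0 0 2] by auto
  moreover have "d \<noteq> 3" using dAB by (cases "A = 0"; cases "B = 0") auto
  moreover have "d = 3 * (2 * A + 3 * B)" "d \<le> 63" using dAB A by auto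
  ultimately show thesis using that by blast
qed

lemma McNugget_cases:
  assumes "n \<in> McNugget"
  obtains k w where "n = 6 * k + w" "w \<in> {0, 9, 20, 29, 40, 49}"
proof -
  have "\<exists>k w. n = 6 * k + w \<and> w \<in> {0, 9, 20, 29, 40, 49}" using assms
  proof (induction n rule: less_induct)
    case (less n)
    show ?case
    proof (cases "divides_in McNugget 6 n")
      case True
      then obtain z where z: "z \<in> McNugget" "n = 6 + z" unfolding divides_in_def by blast
      then obtain k w where "z = 6 * k + w" "w \<in> {0, 9, 20, 29, 40, 49}"
        using less.IH[of z] by auto
      then have "n = 6 * Suc k + w \<and> w \<in> {0, 9, 20, 29, 40, 49}" using z by simp
      then show ?thesis by blast
    next
      case False
      then have "n = 6 * 0 + n \<and> n \<in> {0, 9, 20, 29, 40, 49}"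
        using apery_6[OF less.prems] by simp
      then show ?thesis by blast
    qed
  qed
  then show thesis using that by blast
qed

section \<open>Upper bound for sums of generators\<close>

text \<open>
  Pairs of an element \<open>w\<close> of the Apery set of 6 and the number \<open>(w + d) / 6\<close>, where \<open>d\<close> is the element
  of that set congruent to \<open>-w\<close> modulo 6.
\<close>

definition apery_length :: "(nat \<times> nat) set" where
  "apery_length = {(0, 0), (9, 3), (20, 10), (29, 13), (40, 10), (49, 13)}"

text \<open>The cases are the possible sets of generators that occur. The condition on
  \<open>k\<close> excludes genuine exceptions: 9 + 9 = 6 + 12 and 20 + 20 + 20 = 12 + 48 are
  irreducible but longer than \<open>k + l\<close>.\<close>

lemma generator_sum_step:
  assumes w: "(w, l) \<in> apery_length" and x: "x = 6 * k + w" and k: "w = 0 \<Longrightarrow> 3 \<le> k"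
    and d: "d \<in> McNugget" "6 * a + 9 * b + 20 * c = x + d"
    and long: "k + l < a + b + c"
    and irr6: "0 < a \<Longrightarrow> \<not> divides_in McNugget 6 d"
    and irr9: "0 < b \<Longrightarrow> \<not> divides_in McNugget 9 d"
    and irr20: "0 < c \<Longrightarrow> \<not> divides_in McNugget 20 d"
  shows False
proof -
  have w': "w = 0 \<and> l = 0 \<or> w = 9 \<and> l = 3 \<or> w = 20 \<and> l = 10 \<or> w = 29 \<and> l = 13 \<or> w = 40 \<and> l = 10 \<or> w = 49 \<and> l = 13"
    using w unfolding apery_length_def by auto
  have a6: "d = 0 \<or> d = 9 \<or> d = 20 \<or> d = 29 \<or> d = 40 \<or> d = 49" if "0 < a"
    using apery_6[OF d(1) irr6[OF that]] by simp
  have a9: "d = 0 \<or> d = 6 \<or> d = 12 \<or> d = 20 \<or> d = 26 \<or> d = 32 \<or> d = 40 \<or> d = 46 \<or> d = 52" if "0 < b"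
    using apery_9[OF d(1) irr9[OF that]] by simp
  have a20: "\<exists>e. d = 3 * e \<and> d \<le> 63 \<and> d \<noteq> 3 \<and> d \<noteq> 60" if "0 < c"
    using apery_20[OF d(1) irr20[OF that]] by metis
  have eq: "6 * a + 9 * b + 20 * c = 6 * k + w + d" using d(2) x by simp
  consider "c = 0" "b = 0" "0 < a" | "c = 0" "0 < b" "a = 0" | "c = 0" "0 < b" "0 < a"
    | "0 < c" "b = 0" "a = 0" | "0 < c" "0 < b" "a = 0" | "0 < c" "0 < a"
    using long by linarith
  then show False
  proof cases
    case 1
    then obtain n where "a = k + l + 1 + n" using long by (auto dest!: less_imp_Suc_add)
    \<comment> \<open>So \<open>w + d\<close> is a multiple of 6 above \<open>6 * l\<close>, but the
      only \<open>d\<close> in the Apery set of 6 congruent to \<open>-w\<close> gives exactly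
      \<open>6 * l\<close>.\<close>
    then have "6 * n + 6 * l + 6 = w + d" using eq 1 by simp
    then show ?thesis using w' a6[OF 1(3)] by (elim disjE; simp; presburger)
  next
    case 2
    then obtain n where "b = k + l + 1 + n" using long by (auto dest!: less_imp_Suc_add)
    then have *: "9 * n + 3 * k + 9 * l + 9 = w + d" using eq 2 by simp
    have "d \<le> 52" using a9[OF 2(2)] by auto
    \<comment> \<open>Size leaves only these \<open>w\<close>. Both are multiples of 3, hence so is
      \<open>d\<close>, which forces d \<le> 12.\<close>
    then have w: "w = 0 \<and> l = 0 \<or> w = 9 \<and> l = 3" using w' * by auto
    then have "d = 0 \<or> d = 6 \<or> d = 12" using a9[OF 2(2)] * by (elim disjE; simp; presburger)
    then show ?thesis using w k * by auto
  next
    case 3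
    have d: "d = 0 \<or> d = 20 \<or> d = 40" using a6[OF 3(3)] a9[OF 3(2)] by auto
    obtain n where "a + b = k + l + 1 + n" using 3 long by (auto dest!: less_imp_Suc_add)
    then have "6 * n + 6 * l + 6 + 3 * b = w + d" using eq 3 by simp
    \<comment> \<open>Each combination of \<open>w\<close> and \<open>d\<close> fails either by size
      or modulo 3.\<close>
    then show ?thesis using w' d 3(2) by (elim disjE; simp; presburger)
  next
    case 4
    then obtain n where "c = k + l + 1 + n" using long by (auto dest!: less_imp_Suc_add)
    then have *: "20 * n + 14 * k + 20 * l + 20 = w + d" using eq 4 by simp
    obtain e where e: "d = 3 * e" "d \<le> 63" using a20[OF 4(1)] by blast
    have "w = 0" using w' * e(2) by (elim disjE; simp)
    \<comment> \<open>For k = 3 and n = 0 the equation gives d = 62, within the bound 63 but not a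
      multiple of 3; larger \<open>k\<close> or \<open>n\<close> exceed the bound.\<close>
    then show ?thesis using k * e by presburger
  next
    case 5
    \<comment> \<open>A 20 in the sum makes \<open>d\<close> a multiple of 3; the multiples of 3 in
      the Apery set of 9 are 0, 6, 12, and in that of 6 (next case) 0 and 9. The sum is then too
      large for \<open>x + d\<close>.\<close>
    have "d \<le> 12" using a9[OF 5(2)] a20[OF 5(1)] by (elim disjE; simp; presburger)
    then show ?thesis using w' eq long 5 k by (elim disjE; simp)
  next
    case 6
    have "d \<le> 9" using a6[OF 6(2)] a20[OF 6(1)] by (elim disjE; simp; presburger)
    then show ?thesis using w' eq long 6 by (elim disjE; simp)
  qed
qed

lemma generator_sum_shorten:
  assumes w: "(w, l) \<in> apery_length" and x: "x = 6 * k + w" and k: "w = 0 \<Longrightarrow> 3 \<le> k"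
    and dvd: "divides_in McNugget x (6 * a + 9 * b + 20 * c)"
  shows "\<exists>a' b' c'. a' \<le> a \<and> b' \<le> b \<and> c' \<le> c \<and> a' + b' + c' \<le> k + l \<and>
           divides_in McNugget x (6 * a' + 9 * b' + 20 * c')"
  using dvd
proof (induction "a + b + c" arbitrary: a b c rule: less_induct)
  case less
  show ?case
  proof (cases "a + b + c \<le> k + l")
    case True
    then show ?thesis using less.prems by blast
  next
    case False
    obtain d where d: "d \<in> McNugget" "6 * a + 9 * b + 20 * c = x + d"
      using less.prems unfolding divides_in_def by blast
    have "\<exists>a' b' c'. a' \<le> a \<and> b' \<le> b \<and> c' \<le> c \<and> a' + b' + c' < a + b + c \<and>
            divides_in McNugget x (6 * a' + 9 * b' + 20 * c')"
    proof (rule ccontr)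
      assume no: "\<not> ?thesis"
      show False
      proof (rule generator_sum_step[OF w x k d])
        show "k + l < a + b + c" using False by simp
        show "\<not> divides_in McNugget 6 d" if "0 < a"
        proof
          assume "divides_in McNugget 6 d"
          then obtain z where z: "z \<in> McNugget" "d = 6 + z" unfolding divides_in_def by blast
          have "6 * (a - 1) + 9 * b + 20 * c = x + z" using d(2) z(2) that by linarith
          then have "divides_in McNugget x (6 * (a - 1) + 9 * b + 20 * c)"
            unfolding divides_in_def using z(1) by blast
          then show False using no that by (metis add_less_mono1 diff_le_self diff_less order_refl zero_less_one)
        qed
        show "\<not> divides_in McNugget 9 d" if "0 < b"
        proof
          assume "divides_in McNugget 9 d"
          then obtain z where z: "z \<in> McNugget" "d = 9 + z" unfolding divides_in_def by blast
          have "6 * a + 9 * (b - 1) + 20 * c = x + z" using d(2) z(2) that by linarith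
          then have "divides_in McNugget x (6 * a + 9 * (b - 1) + 20 * c)"
            unfolding divides_in_def using z(1) by blast
          then show False using no that by (metis add_less_mono1 add_less_cancel_left diff_le_self diff_less order_refl zero_less_one)
        qed
        show "\<not> divides_in McNugget 20 d" if "0 < c"
        proof
          assume "divides_in McNugget 20 d"
          then obtain z where z: "z \<in> McNugget" "d = 20 + z" unfolding divides_in_def by blast
          have "6 * a + 9 * b + 20 * (c - 1) = x + z" using d(2) z(2) that by linarith
          then have "divides_in McNugget x (6 * a + 9 * b + 20 * (c - 1))"
            unfolding divides_in_def using z(1) by blast
          then show False using no that by (metis add_less_cancel_left diff_le_self diff_less order_refl zero_less_one)
        qed
      qed
    qed
    then obtain a' b' c' where le: "a' \<le> a" "b' \<le> b" "c' \<le> c" and "a' + b' + c' < a + b + c"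
      "divides_in McNugget x (6 * a' + 9 * b' + 20 * c')" by blast
    from less.hyps[OF this(4,5)] le show ?thesis by (meson order_trans)
  qed
qed

section \<open>From sums of generators to arbitrary sums\<close>

text \<open>Indices with \<open>f i = 0\<close> can be skipped, and every other index contributes at
  least 1. With \<open>f\<close> counting copies of one generator, this finds \<open>n\<close>
  copies inside at most \<open>n\<close> summands.\<close>

lemma subset_sum_ge:
  fixes f :: "'a \<Rightarrow> nat"
  assumes "finite I" "n \<le> sum f I"
  shows "\<exists>T\<subseteq>I. card T \<le> n \<and> n \<le> sum f T"
  using assms
proof (induction I arbitrary: n rule: finite_induct)
  case empty
  then show ?case by auto
next
  case (insert i I)
  show ?case
  proof (cases "n \<le> sum f I")
    case True
    then show ?thesis using insert.IH by (meson subset_insertI2)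
  next
    case False
    have "n - f i \<le> sum f I" using insert by simp
    then obtain T where T: "T \<subseteq> I" "card T \<le> n - f i" "n - f i \<le> sum f T"
      using insert.IH by blast
    have fin: "finite T" "i \<notin> T" using T(1) insert.hyps by (auto intro: finite_subset)
    have "f i > 0" using False insert by (cases "f i = 0") auto
    then have "card (insert i T) \<le> n" "n \<le> sum f (insert i T)"
      using T fin False by auto
    then show ?thesis using T(1) by (meson insert_mono)
  qed
qed

text \<open>A short sum of generators that \<open>x\<close> still divides is covered by at most as
  many of the original summands. Surplus generators in those summands do no harm, by
  monotonicity.\<close>

lemma omega_bound_McNugget:
  assumes w: "(w, l) \<in> apery_length" and x: "x = 6 * k + w" and k: "w = 0 \<Longrightarrow> 3 \<le> k"
  shows "omega_bound McNugget x (k + l)"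
  unfolding omega_bound_def
proof (intro allI impI)
  fix t and y :: "nat \<Rightarrow> nat"
  assume y: "\<forall>i\<in>{1..t}. y i \<in> McNugget"
    and dvd: "divides_in McNugget x (\<Sum>i\<in>{1..t}. y i)"
  have "\<forall>i\<in>{1..t}. \<exists>a b c. y i = 6 * a + 9 * b + 20 * c"
    using y by (meson McNuggetE)
  then obtain a b c where abc: "\<And>i. i \<in> {1..t} \<Longrightarrow> y i = 6 * a i + 9 * b i + 20 * c i"
    by metis
  have sum: "sum y T = 6 * sum a T + 9 * sum b T + 20 * sum c T" if "T \<subseteq> {1..t}" for T
    using that abc by (simp add: sum.distrib sum_distrib_left subset_eq)
  obtain a' b' c' where le: "a' \<le> sum a {1..t}" "b' \<le> sum b {1..t}" "c' \<le> sum c {1..t}"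
    and short: "a' + b' + c' \<le> k + l"
    and dvd': "divides_in McNugget x (6 * a' + 9 * b' + 20 * c')"
    using generator_sum_shorten[OF w x k] dvd sum[OF order_refl] by metis
  obtain A where A: "A \<subseteq> {1..t}" "card A \<le> a'" "a' \<le> sum a A"
    using subset_sum_ge[OF _ le(1)] by auto
  obtain B where B: "B \<subseteq> {1..t}" "card B \<le> b'" "b' \<le> sum b B"
    using subset_sum_ge[OF _ le(2)] by auto
  obtain C where C: "C \<subseteq> {1..t}" "card C \<le> c'" "c' \<le> sum c C"
    using subset_sum_ge[OF _ le(3)] by auto
  define T where "T = A \<union> B \<union> C"
  have T: "T \<subseteq> {1..t}" using A B C unfolding T_def by blast
  then have fin: "finite T" by (rule finite_subset) simp
  have "card T \<le> card A + card B + card C"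
    unfolding T_def by (meson add_le_mono1 card_Un_le order_trans)
  then have "card T \<le> k + l" using A B C short by linarith
  moreover have "sum a A \<le> sum a T" "sum b B \<le> sum b T" "sum c C \<le> sum c T"
    using fin by (auto intro!: sum_mono2 simp: T_def)
  then have "divides_in McNugget x (sum y T)"
    unfolding sum[OF T] using A B C by (intro divides_in_McNugget_mono[OF dvd']) linarith+
  ultimately show "\<exists>T\<subseteq>{1..t}. card T \<le> k + l \<and> divides_in McNugget x (sum y T)"
    using T by blast
qed

section \<open>Lower bound\<close>

text \<open>The witness is \<open>k + l\<close> copies of 6, with sum \<open>x + d\<close>. For a
  subsum \<open>x + z\<close> of 6s, \<open>z\<close> is congruent to \<open>d\<close> modulo 6; as
  \<open>d\<close> is the least such element of the monoid, no copy can be omitted.\<close>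

lemma omega_bound_McNugget_ge:
  assumes w: "(w, l) \<in> apery_length" and x: "x = 6 * k + w" and m: "omega_bound McNugget x m"
  shows "k + l \<le> m"
proof -
  \<comment> \<open>The subtraction does not truncate, since w \<le> 6 * l for every listed
    pair.\<close>
  define d where "d = 6 * l - w"
  have wd: "w + d = 6 * l" "d \<in> {0, 9, 20, 29, 40, 49}"
    using w unfolding apery_length_def d_def by auto
  have six: "6 \<in> McNugget" by (rule McNuggetI[of _ 1 0 0]) simp
  have "d \<in> McNugget"
    using wd(2) McNuggetI[of 0 0 0 0] McNuggetI[of 9 0 1 0] McNuggetI[of 20 0 0 1]
      McNuggetI[of 29 0 1 1] McNuggetI[of 40 0 0 2] McNuggetI[of 49 0 1 2] by auto
  moreover have "(\<Sum>i\<in>{1..k + l}. 6) = x + d" using x wd(1) by simp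
  ultimately have "divides_in McNugget x (\<Sum>i\<in>{1..k + l}. 6)"
    unfolding divides_in_def by blast
  then obtain T where T: "T \<subseteq> {1..k + l}" "card T \<le> m" "divides_in McNugget x (\<Sum>i\<in>T. 6)"
    using m[unfolded omega_bound_def, rule_format, of "k + l" "\<lambda>_. 6"] six by auto
  obtain z where z: "z \<in> McNugget" "card T * 6 = x + z"
    using T(3) unfolding divides_in_def by auto
  obtain j v where v: "z = 6 * j + v" "v \<in> {0, 9, 20, 29, 40, 49}"
    using McNugget_cases[OF z(1)] by blast
  have "v + w + 6 * (k + j) = 6 * card T" using z(2) v(1) x by simp
  then have "6 dvd v + w" by (metis dvd_add_left_iff dvd_triv_left)
  then have "v = d" using v(2) w unfolding apery_length_def d_def by auto
  then have "6 * (k + l) \<le> 6 * card T" using z(2) v(1) x wd(1) by simp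
  then show ?thesis using T(2) by simp
qed

section \<open>Values of omega\<close>

lemma omega_McNugget:
  assumes "(w, l) \<in> apery_length" "w = 0 \<Longrightarrow> 3 \<le> k"
  shows "omega McNugget (6 * k + w) = k + l"
  unfolding omega_def
proof (rule Least_equality)
  show "0 < k + l \<and> omega_bound McNugget (6 * k + w) (k + l)"
    using assms omega_bound_McNugget[OF assms(1) refl assms(2)] by (auto simp: apery_length_def)
  show "k + l \<le> m" if "0 < m \<and> omega_bound McNugget (6 * k + w) m" for m
    using omega_bound_McNugget_ge[OF assms(1) refl] that by blast
qed

lemma McNugget_cases_omega:
  assumes "x \<in> McNugget" "x \<noteq> 0" "x \<noteq> 6" "x \<noteq> 12"
  obtains k w l where "x = 6 * k + w" "(w, l) \<in> apery_length" "w = 0 \<Longrightarrow> 3 \<le> k"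
proof -
  obtain k w where kw: "x = 6 * k + w" "w \<in> {0, 9, 20, 29, 40, 49}"
    using McNugget_cases[OF assms(1)] by blast
  then obtain l where "(w, l) \<in> apery_length" unfolding apery_length_def by auto
  moreover have "3 \<le> k" if "w = 0" using kw(1) that assms(2-4) by presburger
  ultimately show thesis using that kw(1) by blast
qed

theorem theorem4p4:
  shows "(\<forall>x\<in>McNugget. x \<noteq> 0 \<and> x \<noteq> 6 \<and> x \<noteq> 12 \<longrightarrow>
            omega McNugget (x + 6) = omega McNugget x + 1) \<and>
         (\<forall>x\<in>McNugget. x \<noteq> 0 \<and> x \<noteq> 6 \<and> x \<noteq> 12 \<longrightarrow>
            (\<forall>q r :: nat. x = 6 * q + r \<and> r < 6 \<longrightarrow>
               omega McNugget x =
                 (if r = 0 then q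
                  else if r = 1 then q + 5
                  else if r = 2 then q + 7
                  else if r = 3 then q + 2
                  else if r = 4 then q + 4
                  else q + 9)))"
proof (intro conjI ballI impI allI)
  fix x assume x: "x \<in> McNugget" "x \<noteq> 0 \<and> x \<noteq> 6 \<and> x \<noteq> 12"
  then obtain k w l where kwl: "x = 6 * k + w" "(w, l) \<in> apery_length" "w = 0 \<Longrightarrow> 3 \<le> k"
    using McNugget_cases_omega by metis
  \<comment> \<open>Adding 6 keeps the Apery element \<open>w\<close>, hence \<open>l\<close>, and
    raises only \<open>k\<close>.\<close>
  have "omega McNugget (6 * Suc k + w) = Suc k + l"
    using kwl(2,3) by (intro omega_McNugget) (auto intro: le_SucI)
  then show "omega McNugget (x + 6) = omega McNugget x + 1"
    using omega_McNugget[OF kwl(2,3)] kwl(1) by (simp add: add.commute add.left_commute)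
next
  fix x q r :: nat
  assume x: "x \<in> McNugget" "x \<noteq> 0 \<and> x \<noteq> 6 \<and> x \<noteq> 12" and qr: "x = 6 * q + r \<and> r < 6"
  then obtain k w l where kwl: "x = 6 * k + w" "(w, l) \<in> apery_length" "w = 0 \<Longrightarrow> 3 \<le> k"
    using McNugget_cases_omega by metis
  have omega: "omega McNugget x = k + l" using omega_McNugget[OF kwl(2,3)] kwl(1) by simp
  have "q = x div 6" "r = x mod 6" using qr by simp_all
  \<comment> \<open>The constant added to \<open>q\<close> is therefore \<open>l - w div 6\<close>,
    read off from the table for each residue \<open>w mod 6\<close>.\<close>
  then have "q = k + w div 6" "r = w mod 6" using kwl(1) by simp_all
  then show "omega McNugget x =
                 (if r = 0 then q
                  else if r = 1 then q + 5
                  else if r = 2 then q + 7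
                  else if r = 3 then q + 2
                  else if r = 4 then q + 4
                  else q + 9)"
    unfolding omega using kwl(2) by (auto simp: apery_length_def)
qed

end
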